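(* Let $X$ be an almost regular topological space. Then: (1) $\pi w(X)\le (\pi\chi(X))^{c(X)}$. (2) If player two has a winning strategy in the game $G^\omega_1(\mathcal{C}_X,\mathcal{D}_X)$ and $\pi\chi(X)\le\omega$, then $X$ has countable $\pi$-weight.
   Context: $\pi w(X)$ is the $\pi$-weight (least cardinality of a $\pi$-base), $\pi\chi(X)$ is the $\pi$-character (supremum over points $x$ of the least cardinality of a local $\pi$-base at $x$), and $c(X)$ is the cellularity (supremum of the sizes of families of pairwise disjoint non-empty open sets); as is customary, these cardinal functions are taken to be infinite (i.e. replaced by $\aleph_0$ when finite). A space $X$ is almost regular if for every non-empty open set $U\subset X$ there is a non-empty open set $V$ such that $\overline{V}\subset U$. For an ordinal $\alpha$ and collections of sets $\mathcal{A},\mathcal{B}$, $G^\alpha_1(\mathcal{A},\mathcal{B})$ denotes the two-player game of length $\alpha$ in which, at inning $\beta<\alpha$, player one chooses $\mathcal{U}_\beta\in\mathcal{A}$ and player two responds with an element $V_\beta\in\mathcal{U}_\beta$. Player two wins if and only if $\{V_\beta:\beta<\alpha\}\in\mathcal{B}$. $\mathcal{C}_X$ is the collection of all maximal families of pairwise disjoint non-empty open subsets of $X$, and $\mathcal{D}_X$ is the collection of all families $\mathcal{U}$ of open subsets of $X$ such that $\bigcup\mathcal{U}$ is dense in $X$. *)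

theory Defs
  imports "HOL-Analysis.Analysis"
begin

unbundle cardinal_syntax

section \<open>Infima and suprema of cardinals\<close>

text \<open>
  Cardinals are represented, as in the library, by relations \<open>r\<close> with \<open>Card_order r\<close>, compared
  by \<open>\<le>o\<close> and identified up to \<open>=o\<close>.  The choice operators below are determined up
  to \<open>=o\<close>; \<open>card_least\<close> is meant for nonempty sets of cardinals.
\<close>

definition card_least :: "'b rel set \<Rightarrow> 'b rel" where
  "card_least R = (SOME r. r \<in> R \<and> (\<forall>s\<in>R. r \<le>o s))"

definition card_Sup :: "'b rel set \<Rightarrow> 'b rel" where
  "card_Sup R = (SOME k. Card_order k \<and> (\<forall>r\<in>R. r \<le>o k) \<and>
     (\<forall>k'::'b rel. Card_order k' \<and> (\<forall>r\<in>R. r \<le>o k') \<longrightarrow> k \<le>o k'))"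

text \<open>
  The convention that a cardinal function is infinite: adding \<open>natLeq\<close> (the cardinal aleph-zero)
  leaves an infinite cardinal unchanged and turns a finite one into aleph-zero.
\<close>

definition infinitize :: "'b rel \<Rightarrow> ('b + nat) rel" where
  "infinitize r = r +c natLeq"

lemma card_least:
  assumes "R \<noteq> {}" and "\<And>r. r \<in> R \<Longrightarrow> Card_order r"
  shows "card_least R \<in> R" and "\<And>s. s \<in> R \<Longrightarrow> card_least R \<le>o s"
proof -
  have "\<exists>r. r \<in> R \<and> (\<forall>s\<in>R. r \<le>o s)"
    using exists_minim_Card_order[of R] assms by blast
  then have "card_least R \<in> R \<and> (\<forall>s\<in>R. card_least R \<le>o s)"
    unfolding card_least_def by (rule someI_ex)
  then show "card_least R \<in> R" and "\<And>s. s \<in> R \<Longrightarrow> card_least R \<le>o s" by auto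
qed

lemma card_Sup:
  fixes R :: "'b rel set"
  assumes "\<And>r. r \<in> R \<Longrightarrow> Card_order r"
  shows "Card_order (card_Sup R)"
    and "\<And>r. r \<in> R \<Longrightarrow> r \<le>o card_Sup R"
    and "\<And>k :: 'c rel. Card_order k \<Longrightarrow> (\<And>r. r \<in> R \<Longrightarrow> r \<le>o k) \<Longrightarrow> card_Sup R \<le>o k"
proof -
  let ?K = "{k::'b rel. Card_order k \<and> (\<forall>r\<in>R. r \<le>o k)}"
  have "|UNIV::'b set| \<in> ?K"
  proof -
    have "r \<le>o |UNIV::'b set|" if "r \<in> R" for r
      using assms[OF that] card_of_Field_ordIso[of r] card_of_mono1[of "Field r" UNIV]
      by (meson subset_UNIV ordIso_symmetric ordIso_ordLeq_trans)
    then show ?thesis by (simp add: card_of_Card_order)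
  qed
  then have "\<exists>k\<in>?K. \<forall>k'\<in>?K. k \<le>o k'"
    by (intro exists_minim_Card_order) auto
  then have "\<exists>k::'b rel. Card_order k \<and> (\<forall>r\<in>R. r \<le>o k) \<and>
      (\<forall>k'::'b rel. Card_order k' \<and> (\<forall>r\<in>R. r \<le>o k') \<longrightarrow> k \<le>o k')"
    by (simp add: Bex_def conj_assoc)
  then have S: "Card_order (card_Sup R) \<and> (\<forall>r\<in>R. r \<le>o card_Sup R) \<and>
      (\<forall>k'::'b rel. Card_order k' \<and> (\<forall>r\<in>R. r \<le>o k') \<longrightarrow> card_Sup R \<le>o k')"
    unfolding card_Sup_def by (rule someI_ex)
  then show C: "Card_order (card_Sup R)" and "\<And>r. r \<in> R \<Longrightarrow> r \<le>o card_Sup R" by auto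
  fix k :: "'c rel"
  assume k: "Card_order k" and ub: "\<And>r. r \<in> R \<Longrightarrow> r \<le>o k"
  show "card_Sup R \<le>o k"
  proof (rule ccontr)
    assume "\<not> card_Sup R \<le>o k"
    then have "k <o card_Sup R"
      using C k by (simp add: card_order_on_well_order_on not_ordLeq_iff_ordLess)
    then have "k \<le>o card_Sup R" by (rule ordLess_imp_ordLeq)
    then obtain B where B: "k =o |B :: 'b set|"
      using internalize_card_of_ordLeq[of "Field k" "card_Sup R"] card_of_Field_ordIso[OF k]
      by (meson ordIso_ordLeq_trans ordIso_symmetric ordIso_transitive)
    then have "\<forall>r\<in>R. r \<le>o |B|" using ub ordLeq_ordIso_trans by blast
    then have "card_Sup R \<le>o |B|" using S card_of_Card_order by blast
    then have "card_Sup R \<le>o k" using B ordIso_symmetric ordLeq_ordIso_trans by blast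
    with \<open>\<not> card_Sup R \<le>o k\<close> show False by blast
  qed
qed

lemma infinitize:
  assumes "Card_order r"
  shows "infinite (Field r) \<Longrightarrow> infinitize r =o r"
    and "finite (Field r) \<Longrightarrow> infinitize r =o natLeq"
proof -
  show "infinitize r =o r" if "infinite (Field r)"
    unfolding infinitize_def using that assms
    by (intro csum_absorb1) (auto simp: cinfinite_def intro: natLeq_ordLeq_cinfinite)
  show "infinitize r =o natLeq" if "finite (Field r)"
    unfolding infinitize_def using that assms
    by (intro csum_absorb2 natLeq_Cinfinite ordLess_imp_ordLeq Cfinite_ordLess_Cinfinite)
       (auto simp: cfinite_def)
qed

section \<open>Cardinal functions of a topological space\<close>

definition pi_base :: "'a topology \<Rightarrow> 'a set set \<Rightarrow> bool" where
  "pi_base X \<B> \<longleftrightarrow> (\<forall>B\<in>\<B>. openin X B \<and> B \<noteq> {}) \<and>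
     (\<forall>U. openin X U \<and> U \<noteq> {} \<longrightarrow> (\<exists>B\<in>\<B>. B \<subseteq> U))"

text \<open>The members of a local pi-base at \<open>x\<close> are not required to contain \<open>x\<close>.\<close>

definition local_pi_base :: "'a topology \<Rightarrow> 'a \<Rightarrow> 'a set set \<Rightarrow> bool" where
  "local_pi_base X x \<B> \<longleftrightarrow> (\<forall>B\<in>\<B>. openin X B \<and> B \<noteq> {}) \<and>
     (\<forall>U. openin X U \<and> x \<in> U \<longrightarrow> (\<exists>B\<in>\<B>. B \<subseteq> U))"

definition cellular :: "'a topology \<Rightarrow> 'a set set \<Rightarrow> bool" where
  "cellular X \<U> \<longleftrightarrow> (\<forall>U\<in>\<U>. openin X U \<and> U \<noteq> {}) \<and> pairwise disjnt \<U>"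

definition pi_weight :: "'a topology \<Rightarrow> ('a set + nat) rel" where
  "pi_weight X = infinitize (card_least {|\<B>| |\<B>. pi_base X \<B>})"

definition pi_character :: "'a topology \<Rightarrow> ('a set + nat) rel" where
  "pi_character X =
     infinitize (card_Sup {card_least {|\<B>| |\<B>. local_pi_base X x \<B>} |x. x \<in> topspace X})"

definition cellularity :: "'a topology \<Rightarrow> ('a set + nat) rel" where
  "cellularity X = infinitize (card_Sup {|\<U>| |\<U>. cellular X \<U>})"

definition almost_regular :: "'a topology \<Rightarrow> bool" where
  "almost_regular X \<longleftrightarrow> (\<forall>U. openin X U \<and> U \<noteq> {} \<longrightarrow>
     (\<exists>V. openin X V \<and> V \<noteq> {} \<and> X closure_of V \<subseteq> U))"

section \<open>Selection games\<close>

text \<open>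
  The length of the game is the order type of a well-order \<open>r\<close>, whose field is the set of innings;
  the game of length \<open>\<omega>\<close> is obtained for \<open>r = natLeq\<close>.  A strategy \<open>\<sigma>\<close> of player two
  sees, at inning \<open>\<beta>\<close>, exactly the moves of player one in the innings up to and including \<open>\<beta>\<close>.
\<close>

definition G1_play :: "'i rel \<Rightarrow> ('i \<Rightarrow> ('i \<Rightarrow> 'm set) \<Rightarrow> 'm) \<Rightarrow> ('i \<Rightarrow> 'm set) \<Rightarrow> 'i \<Rightarrow> 'm" where
  "G1_play r \<sigma> U \<beta> = \<sigma> \<beta> (restrict U (under r \<beta>))"

definition G1_winning_strategy_two ::
    "'i rel \<Rightarrow> 'm set set \<Rightarrow> 'm set set \<Rightarrow> ('i \<Rightarrow> ('i \<Rightarrow> 'm set) \<Rightarrow> 'm) \<Rightarrow> bool" where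
  "G1_winning_strategy_two r \<A> \<B> \<sigma> \<longleftrightarrow>
     (\<forall>U. (\<forall>\<beta>\<in>Field r. U \<beta> \<in> \<A>) \<longrightarrow>
        (\<forall>\<beta>\<in>Field r. G1_play r \<sigma> U \<beta> \<in> U \<beta>) \<and> G1_play r \<sigma> U ` Field r \<in> \<B>)"

definition maximal_cellular_families :: "'a topology \<Rightarrow> 'a set set set" where
  "maximal_cellular_families X =
     {\<U>. cellular X \<U> \<and> (\<forall>\<V>. cellular X \<V> \<and> \<U> \<subseteq> \<V> \<longrightarrow> \<V> = \<U>)}"

definition dense_union_families :: "'a topology \<Rightarrow> 'a set set set" where
  "dense_union_families X =
     {\<U>. (\<forall>U\<in>\<U>. openin X U) \<and> X closure_of (\<Union>\<U>) = topspace X}"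

end

theory Submission
  imports Defs "HOL-Library.Countable_Set_Type"
begin

text \<open>
  Write \<open>\<kappa>\<close> for the pi-character and \<open>\<lambda>\<close> for the cellularity.

  For the cardinal bound, close off: to every family \<open>\<V>\<close> of open sets whose union is not dense,
  assign a local pi-base at some point outside the closure of \<open>\<Union>\<V>\<close>.  Since
  \<open>\<kappa>\<^sup>\<lambda>\<close> is unchanged by raising it to the power \<open>\<lambda>\<close>, there is a collection \<open>\<B>\<close> of at most
  \<open>\<kappa>\<^sup>\<lambda>\<close> nonempty open sets that contains the local pi-bases assigned to its subfamilies of size at
  most \<open>\<lambda>\<close> (\<open>small_set_closed_under_small_operations\<close>).  Such a \<open>\<B>\<close> is a pi-base.  Given a nonempty
  open \<open>U\<close>, almost regularity provides a nonempty open \<open>V\<close> with closure inside \<open>U\<close>.  Take a maximal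
  disjoint family \<open>\<V>\<close> of members of \<open>\<B>\<close> that miss \<open>V\<close>; it has at most \<open>\<lambda>\<close> members, and its union
  is not dense, so \<open>\<B>\<close> contains a local pi-base at some \<open>x\<close> outside the closure of \<open>\<Union>\<V>\<close>.  If
  \<open>x\<close> were outside the closure of \<open>V\<close>, some member of this local pi-base would miss both \<open>V\<close> and
  \<open>\<Union>\<V>\<close>, against maximality.  So \<open>x\<close> lies in the closure of \<open>V\<close>, hence in \<open>U\<close>, and a member of
  the local pi-base lies in \<open>U\<close>.

  For the game, fix a winning strategy of player two.  At every position, all nonempty open subsets
  of some nonempty open set \<open>G\<close> occur as player two's next answers: otherwise the sets that are never
  answers would form a pi-base, player one could play a maximal cellular family made of such sets,
  and player two would have no legal answer (\<open>open_set_of_responses\<close>).  If the pi-character is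
  countable, choose a point of \<open>G\<close> and let player one restrict attention to countably many moves
  whose answers form a local pi-base at that point.  This gives a tree with countable branching and
  height \<open>\<omega>\<close>, and the countably many answers occurring in it form a pi-base.  For if none of the
  chosen points were in \<open>U\<close>, they would all be outside the closure of \<open>V\<close>, with \<open>V\<close> as above; then
  player one could move along a branch all of whose answers miss \<open>V\<close> and win.
\<close>

section \<open>Maximal disjoint families\<close>

lemma maximal_disjoint_subfamily:
  "\<exists>\<V>. \<V> \<subseteq> \<P> \<and> pairwise disjnt \<V> \<and> (\<forall>B\<in>\<P>. (\<forall>V\<in>\<V>. disjnt B V) \<longrightarrow> B \<in> \<V>)"
proof -
  let ?A = "{\<V>. \<V> \<subseteq> \<P> \<and> pairwise disjnt \<V>}"
  have "\<Union>C \<in> ?A" if "subset.chain ?A C" for C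
  proof -
    have "pairwise disjnt (\<Union>C)"
      using that unfolding subset_chain_def
      by (intro pairwise_chain_Union) (blast, simp add: chain_subset_def)
    moreover have "\<Union>C \<subseteq> \<P>" using that unfolding subset_chain_def by blast
    ultimately show ?thesis by simp
  qed
  then have "\<exists>\<V>\<in>?A. \<forall>\<W>\<in>?A. \<V> \<subseteq> \<W> \<longrightarrow> \<W> = \<V>"
    by (rule subset_Zorn')
  then obtain \<V> where \<V>: "\<V> \<in> ?A" and max: "\<And>\<W>. \<W> \<in> ?A \<Longrightarrow> \<V> \<subseteq> \<W> \<Longrightarrow> \<W> = \<V>"
    by (elim bexE) metis
  show ?thesis
  proof (intro exI[of _ \<V>] conjI ballI impI)
    show "\<V> \<subseteq> \<P>" "pairwise disjnt \<V>" using \<V> by auto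
    fix B assume "B \<in> \<P>" "\<forall>V\<in>\<V>. disjnt B V"
    then have "insert B \<V> \<in> ?A"
      using \<V> by (auto simp: pairwise_insert disjnt_sym)
    then show "B \<in> \<V>" using max[of "insert B \<V>"] by blast
  qed
qed

section \<open>Closing off under operations on small subsets\<close>

lemma card_of_small_subsets:
  assumes r: "Cinfinite r" and s: "Card_order s"
  shows "|{D. D \<subseteq> Field r \<and> |D| \<le>o s}| \<le>o r ^c s +c r"
proof -
  let ?F = "Func (Field s) (Field r)"
  have "{D. D \<subseteq> Field r \<and> |D| \<le>o s} \<subseteq> (\<lambda>f. f ` Field s) ` ?F \<union> {{}}"
  proof
    fix D assume "D \<in> {D. D \<subseteq> Field r \<and> |D| \<le>o s}"
    then have D: "D \<subseteq> Field r" "|D| \<le>o s" by auto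
    show "D \<in> (\<lambda>f. f ` Field s) ` ?F \<union> {{}}"
    proof (cases "D = {}")
      case False
      moreover have "|D| \<le>o |Field s|"
        by (rule ordLeq_ordIso_trans[OF D(2) ordIso_symmetric[OF card_of_Field_ordIso[OF s]]])
      ultimately obtain g where g: "g ` Field s = D" using card_of_ordLeq2[of D "Field s"] by blast
      let ?g = "\<lambda>i. if i \<in> Field s then g i else undefined"
      have "?g \<in> ?F" using g D(1) by (auto simp: Func_def)
      moreover have "?g ` Field s = D" using g by auto
      ultimately show ?thesis by blast
    qed simp
  qed
  then have "|{D. D \<subseteq> Field r \<and> |D| \<le>o s}| \<le>o |(\<lambda>f. f ` Field s) ` ?F \<union> {{}}|"
    by (rule card_of_mono1)
  also have "|(\<lambda>f. f ` Field s) ` ?F \<union> {{}}| \<le>o |(\<lambda>f. f ` Field s) ` ?F| +c |{{} :: 'a set}|"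
    by (rule Un_csum)
  also have "|(\<lambda>f. f ` Field s) ` ?F| +c |{{} :: 'a set}| \<le>o r ^c s +c r"
  proof (rule csum_mono)
    show "|(\<lambda>f. f ` Field s) ` ?F| \<le>o r ^c s"
      unfolding cexp_def by (rule card_of_image)
    have "|{{} :: 'a set}| <o r"
      using r by (intro Cfinite_ordLess_Cinfinite) (simp_all add: cfinite_def card_of_card_order_on Field_card_of)
    then show "|{{} :: 'a set}| \<le>o r" by (rule ordLess_imp_ordLeq)
  qed
  finally show ?thesis .
qed

text \<open>
  A code \<open>c\<close> names an element by a label \<open>k c\<close> and the set \<open>D c\<close> of codes of the elements to which
  the operation \<open>g\<close> is applied.  The relation \<open>D\<close> may have infinite descents; their codes name
  nothing, because the predicate is the least one.  Hence the named elements can be counted by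
  counting codes, without any iteration along ordinals.
\<close>

inductive coded :: "('c \<Rightarrow> 'c set) \<Rightarrow> ('c \<Rightarrow> 'c) \<Rightarrow> ('b set \<Rightarrow> 'c \<Rightarrow> 'b) \<Rightarrow> 'c \<Rightarrow> 'b \<Rightarrow> bool"
  for D k g where
  codedI: "(\<And>d. d \<in> D c \<Longrightarrow> coded D k g d (v d)) \<Longrightarrow> coded D k g c (g (v ` D c) (k c))"

lemma coded_unique: "coded D k g c y \<Longrightarrow> coded D k g c z \<Longrightarrow> z = y"
proof (induction arbitrary: z rule: coded.induct)
  case (codedI c v)
  from codedI.prems obtain w where w: "z = g (w ` D c) (k c)" "\<And>d. d \<in> D c \<Longrightarrow> coded D k g d (w d)"
    by cases auto
  then have "w ` D c = v ` D c" using codedI.IH by (intro image_cong) auto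
  with w show ?case by simp
qed

text \<open>
  The condition \<open>r ^c s \<le>o r\<close> makes it possible to use the elements of \<open>Field r\<close> as codes: there are
  enough of them to encode every pair of a label and a set of at most \<open>s\<close> codes.  The elements that
  receive a code are then closed under the operations, and there are no more of them than codes.
\<close>

lemma small_set_closed_under_small_operations:
  fixes r :: "'c rel" and \<Psi> :: "'b set \<Rightarrow> 'b set"
  assumes r: "Cinfinite r" and s: "Card_order s" and rs: "r ^c s \<le>o r"
    and \<Psi>: "\<And>V. |\<Psi> V| \<le>o r"
  obtains S where "|S| \<le>o r" and "\<And>V. V \<subseteq> S \<Longrightarrow> |V| \<le>o s \<Longrightarrow> \<Psi> V \<subseteq> S"
proof -
  let ?C = "Field r" and ?P = "{D. D \<subseteq> Field r \<and> |D| \<le>o s}"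
  have C: "|?C| =o r" using r card_of_Field_ordIso by blast
  have toC: "|A| \<le>o |?C|" if "|A| \<le>o r" for A :: "'d set"
    using that C ordIso_symmetric ordLeq_ordIso_trans by blast
  have "\<exists>e. \<Psi> V \<subseteq> e ` ?C" for V
  proof (cases "\<Psi> V = {}")
    case False
    then show ?thesis using card_of_ordLeq2[of "\<Psi> V" ?C] toC[OF \<Psi>[of V]] by blast
  qed auto
  then obtain g where g: "\<And>V. \<Psi> V \<subseteq> g V ` ?C" by metis
  have "|?P| \<le>o r"
    using card_of_small_subsets[OF r s] csum_cinfinite_bound[OF rs _ Card_order_cexp _ r, of r]
      r ordLeq_refl ordLeq_transitive by blast
  then have "|?P \<times> ?C| \<le>o |?C|"
    using cprod_cinfinite_bound[OF _ ordIso_imp_ordLeq[OF C] card_of_Card_order card_of_Card_order r]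
    by (intro toC) (simp add: cprod_def Field_card_of)
  moreover have "?P \<times> ?C \<noteq> {}"
  proof -
    have "{} \<in> ?P" using s by (simp add: Card_order_empty)
    moreover have "?C \<noteq> {}" using r by (auto simp: cinfinite_def)
    ultimately show ?thesis by blast
  qed
  \<comment> \<open>\<open>h\<close> decodes: it sends a code to the codes of the arguments and the label.\<close>
  ultimately obtain h where h: "h ` ?C = ?P \<times> ?C" using card_of_ordLeq2[of "?P \<times> ?C" ?C] by blast
  let ?code = "coded (fst \<circ> h) (snd \<circ> h) g"
  define S where "S = {y. \<exists>c\<in>?C. ?code c y}"
  show thesis
  proof
    have "S \<subseteq> (\<lambda>c. THE y. ?code c y) ` ?C"
    proof
      fix y assume "y \<in> S"
      then obtain c where c: "c \<in> ?C" "?code c y" by (auto simp: S_def)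
      then have "(THE y. ?code c y) = y" by (intro the_equality) (auto intro: coded_unique)
      with c show "y \<in> (\<lambda>c. THE y. ?code c y) ` ?C" by force
    qed
    then have "|S| \<le>o |?C|" by (rule surj_imp_ordLeq)
    then show "|S| \<le>o r" using C ordLeq_ordIso_trans by blast
  next
    fix V assume V: "V \<subseteq> S" "|V| \<le>o s"
    show "\<Psi> V \<subseteq> S"
    proof
      fix y assume "y \<in> \<Psi> V"
      then obtain k where k: "k \<in> ?C" "y = g V k" using g by blast
      obtain d where d: "\<And>v. v \<in> V \<Longrightarrow> d v \<in> ?C \<and> ?code (d v) v"
        using V(1) unfolding S_def subset_eq mem_Collect_eq by metis
      have "d ` V \<in> ?P"
        using d V(2) card_of_image[of d V] ordLeq_transitive by blast
      then have "(d ` V, k) \<in> h ` ?C" using h k by blast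
      then obtain c where c: "c \<in> ?C" "h c = (d ` V, k)" by force
      have inj: "inj_on d V" 
      proof (rule inj_onI)
        fix x y assume "x \<in> V" "y \<in> V" "d x = d y"
        then show "x = y" using d[of x] d[of y] coded_unique[of "fst \<circ> h" "snd \<circ> h" g "d x" y x] by simp
      qed
      let ?v = "the_inv_into V d"
      have "?code c (g (?v ` (fst \<circ> h) c) ((snd \<circ> h) c))"
        by (rule codedI) (use c d inj in \<open>auto simp: the_inv_into_f_f\<close>)
      moreover have "?v ` (fst \<circ> h) c = V"
        using c inj by (force simp: image_image the_inv_into_f_f)
      ultimately have "?code c y" using c k by simp
      with c show "y \<in> S" by (auto simp: S_def)
    qed
  qed
qed

section \<open>Families realising the cardinal functions\<close>

lemma Cinfinite_infinitize: "Cinfinite (infinitize r)"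
  unfolding infinitize_def using Cinfinite_csum natLeq_Cinfinite by blast

lemma ordLeq_infinitize: "Card_order r \<Longrightarrow> r \<le>o infinitize r"
  unfolding infinitize_def by (rule ordLeq_csum1)

lemma pi_weight_le:
  assumes "pi_base X \<B>" and "|\<B>| \<le>o r" and "Cinfinite r"
  shows "pi_weight X \<le>o r"
proof -
  let ?R = "{|\<B>| |\<B>. pi_base X \<B>}"
  have R: "?R \<noteq> {}" "\<And>r. r \<in> ?R \<Longrightarrow> Card_order r"
    using assms(1) card_of_Card_order by auto
  have "card_least ?R \<le>o |\<B>|" using card_least(2)[OF R] assms(1) by blast
  moreover have "Card_order (card_least ?R)" using card_least(1)[OF R] R(2) by blast
  ultimately show ?thesis
    unfolding pi_weight_def infinitize_def
    using assms natLeq_ordLeq_cinfinite[of r] ordLeq_transitive natLeq_Card_order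
    by (intro csum_cinfinite_bound) blast+
qed

lemma obtain_local_pi_base:
  assumes "x \<in> topspace X"
  obtains \<B> where "local_pi_base X x \<B>" and "|\<B>| \<le>o pi_character X"
proof -
  let ?R = "\<lambda>x. {|\<B>| |\<B>. local_pi_base X x \<B>}"
  let ?S = "{card_least (?R x) |x. x \<in> topspace X}"
  have ne: "?R x \<noteq> {}" for x
  proof -
    have "local_pi_base X x {U. openin X U \<and> U \<noteq> {}}"
      by (auto simp: local_pi_base_def)
    then show ?thesis by blast
  qed
  have least: "card_least (?R x) \<in> ?R x" for x
    by (rule card_least(1)[OF ne]) (auto intro: card_of_Card_order)
  have S: "\<And>r. r \<in> ?S \<Longrightarrow> Card_order r"
    using least by (smt (verit) mem_Collect_eq card_of_Card_order)
  obtain \<B> where \<B>: "card_least (?R x) = |\<B>|" "local_pi_base X x \<B>"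
    using least[of x] by auto
  have "|\<B>| \<in> ?S" using \<B>(1)[symmetric] assms by blast
  then have "|\<B>| \<le>o card_Sup ?S" by (rule card_Sup(2)[rotated]) (rule S)
  also have "card_Sup ?S \<le>o pi_character X"
    unfolding pi_character_def by (rule ordLeq_infinitize[OF card_Sup(1)[OF S]])
  finally show thesis using that \<B>(2) by blast
qed

lemma cellular_le_cellularity:
  assumes "cellular X \<U>"
  shows "|\<U>| \<le>o cellularity X"
proof -
  let ?S = "{|\<U>| |\<U>. cellular X \<U>}"
  have S: "\<And>r. r \<in> ?S \<Longrightarrow> Card_order r" using card_of_Card_order by auto
  have "|\<U>| \<le>o card_Sup ?S" using assms by (intro card_Sup(2)[OF S]) auto
  also have "card_Sup ?S \<le>o cellularity X"
    unfolding cellularity_def by (rule ordLeq_infinitize[OF card_Sup(1)[OF S]])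
  finally show ?thesis .
qed

section \<open>The bound on the pi-weight\<close>

text \<open>
  Here the general closure lemma is applied with \<open>r\<close> the power itself and \<open>s\<close> the cellularity: cellular
  subfamilies of the closed collection are exactly small enough to be operated on.
\<close>

theorem pi_weight_le_pi_character_cexp_cellularity:
  fixes X :: "'a topology"
  assumes X: "almost_regular X"
  shows "pi_weight X \<le>o pi_character X ^c cellularity X"
proof -
  let ?k = "pi_character X" and ?s = "cellularity X"
  let ?r = "?k ^c ?s"
  have k: "Cinfinite ?k" and s: "Cinfinite ?s"
    unfolding pi_character_def cellularity_def by (rule Cinfinite_infinitize)+
  have r: "Cinfinite ?r" using k s ctwo_ordLeq_Cinfinite by (intro Cinfinite_cexp) auto
  have kr: "?k \<le>o ?r" using k s Cinfinite_Cnotzero by (intro ordLeq_cexp1) auto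
  have rs: "?r ^c ?s \<le>o ?r"
    using k s Cinfinite_Cnotzero[OF s] ordLeq_refl[of ?s] ordIso_refl[of ?s]
    by (intro ordIso_imp_ordLeq cexp_cprod_ordLeq) auto
  have "\<exists>\<L>. local_pi_base X x \<L> \<and> |\<L>| \<le>o ?k" if "x \<in> topspace X" for x
    using obtain_local_pi_base[OF that] by metis
  then obtain L where L: "\<And>x. x \<in> topspace X \<Longrightarrow> local_pi_base X x (L x)"
    and Lk: "\<And>x. x \<in> topspace X \<Longrightarrow> |L x| \<le>o ?k" by metis
  \<comment> \<open>The operation to close off under; \<open>{}\<close> is a dummy value for families with dense union.\<close>
  define out where "out \<V> = topspace X - X closure_of \<Union>\<V>" for \<V>
  define \<Psi> where "\<Psi> \<V> = (if out \<V> = {} then {} else L (SOME x. x \<in> out \<V>))" for \<V>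
  have out: "(SOME x. x \<in> out \<V>) \<in> out \<V>" if "out \<V> \<noteq> {}" for \<V>
    using that by (simp add: some_in_eq)
  have "|\<Psi> \<V>| \<le>o ?r" for \<V>
  proof (cases "out \<V> = {}")
    case False
    then have "|\<Psi> \<V>| \<le>o ?k" using Lk out by (auto simp: \<Psi>_def out_def)
    then show ?thesis using kr by (rule ordLeq_transitive)
  next
    case True
    then show ?thesis using r by (simp add: \<Psi>_def Card_order_empty)
  qed
  then obtain S where S: "|S| \<le>o ?r"
    and clo: "\<And>\<V>. \<V> \<subseteq> S \<Longrightarrow> |\<V>| \<le>o ?s \<Longrightarrow> \<Psi> \<V> \<subseteq> S"
    using small_set_closed_under_small_operations[OF r conjunct2[OF s] rs, of \<Psi>] by metis
  define \<B> where "\<B> = {B \<in> S. openin X B \<and> B \<noteq> {}}"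
  have "\<exists>B\<in>\<B>. B \<subseteq> U" if U: "openin X U" "U \<noteq> {}" for U
  proof -
    obtain V where V: "openin X V" "V \<noteq> {}" "X closure_of V \<subseteq> U"
      using X U unfolding almost_regular_def by blast
    obtain \<V> where \<V>: "\<V> \<subseteq> {B \<in> \<B>. disjnt B V}" "pairwise disjnt \<V>"
      and max: "\<forall>B\<in>{B \<in> \<B>. disjnt B V}. (\<forall>C\<in>\<V>. disjnt B C) \<longrightarrow> B \<in> \<V>"
      using maximal_disjoint_subfamily[of "{B \<in> \<B>. disjnt B V}"] by (elim exE conjE) (rule that)
    have opn: "openin X B" "B \<noteq> {}" if "B \<in> \<V>" for B using that \<V>(1) by (auto simp: \<B>_def)
    have "cellular X \<V>" using \<V> opn by (auto simp: cellular_def)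
    then have "\<Psi> \<V> \<subseteq> S"
      using \<V>(1) by (intro clo cellular_le_cellularity) (auto simp: \<B>_def)
    moreover have "V \<inter> X closure_of \<Union>\<V> = {}"
      using \<V>(1) V(1) by (subst openin_Int_closure_of_eq_empty) (auto simp: disjnt_def)
    then have ne: "out \<V> \<noteq> {}"
      using V openin_subset unfolding out_def by blast
    define x where "x = (SOME x. x \<in> out \<V>)"
    have x: "x \<in> topspace X" "x \<notin> X closure_of \<Union>\<V>" using out[OF ne] by (auto simp: x_def out_def)
    ultimately have LS: "L x \<subseteq> S" using ne by (simp add: \<Psi>_def x_def)
    have LB: "\<And>B. B \<in> L x \<Longrightarrow> B \<in> \<B>"
      using LS L[OF x(1)] by (auto simp: \<B>_def local_pi_base_def)
    have Lx: "\<exists>B\<in>L x. B \<subseteq> W" if "openin X W" "x \<in> W" for W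
      using that L[OF x(1)] unfolding local_pi_base_def by blast
    have "x \<in> X closure_of V"
    proof (rule ccontr)
      let ?W = "(topspace X - X closure_of V) - X closure_of \<Union>\<V>"
      assume "x \<notin> X closure_of V"
      then have "x \<in> ?W" using x by simp
      moreover have "openin X ?W" by (intro openin_diff) simp_all
      ultimately obtain B where B: "B \<in> L x" "B \<subseteq> ?W" using Lx by metis
      have "V \<subseteq> X closure_of V" "\<Union>\<V> \<subseteq> X closure_of \<Union>\<V>"
        by (intro closure_of_subset Union_least openin_subset V(1) opn(1); assumption)+
      then have "disjnt B V" and disj: "disjnt B (\<Union>\<V>)"
        using B(2) by (auto simp: disjnt_def)
      then have "B \<in> \<V>" using LB[OF B(1)] by (intro max[rule_format]) (auto simp: disjnt_def)
      then have "B \<subseteq> \<Union>\<V>" by (rule Union_upper)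
      with disj opn(2)[OF \<open>B \<in> \<V>\<close>] show False by (auto simp: disjnt_def)
    qed
    then show ?thesis using Lx[of U] U V(3) LB by blast
  qed
  then have "pi_base X \<B>" by (auto simp: pi_base_def \<B>_def)
  moreover have "|\<B>| \<le>o ?r"
    by (rule ordLeq_transitive[OF card_of_mono1 S]) (auto simp: \<B>_def)
  ultimately show ?thesis using r by (rule pi_weight_le)
qed

section \<open>The game\<close>

lemma G1_play_cong:
  assumes "\<And>i. i \<in> under r \<beta> \<Longrightarrow> U i = U' i"
  shows "G1_play r \<sigma> U \<beta> = G1_play r \<sigma> U' \<beta>"
  using assms unfolding G1_play_def by (intro arg_cong[of _ _ "\<sigma> \<beta>"] restrict_ext)

lemma under_natLeq: "under natLeq n = {..n}"
  by (auto simp: under_def natLeq_def)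

text \<open>
  Positions are represented by the list of the moves that player one has made, as player two's
  earlier moves are determined by the strategy.
\<close>

definition response :: "(nat \<Rightarrow> (nat \<Rightarrow> 'm set) \<Rightarrow> 'm) \<Rightarrow> 'm set list \<Rightarrow> 'm set \<Rightarrow> 'm" where
  "response \<sigma> P \<U> = G1_play natLeq \<sigma> (\<lambda>i. (P @ [\<U>]) ! i) (length P)"

lemma response_in_move:
  assumes \<sigma>: "G1_winning_strategy_two natLeq \<A> \<D> \<sigma>" and P: "set P \<subseteq> \<A>" "\<U> \<in> \<A>"
  shows "response \<sigma> P \<U> \<in> \<U>"
proof -
  let ?U = "\<lambda>i. if i < length P then P ! i else \<U>"
  have "\<forall>n\<in>Field natLeq. ?U n \<in> \<A>" using P by (auto dest: nth_mem)
  then have "G1_play natLeq \<sigma> ?U (length P) \<in> ?U (length P)"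
    using \<sigma>[unfolded G1_winning_strategy_two_def, THEN spec, of ?U] by (simp only: Field_natLeq) blast
  moreover have "response \<sigma> P \<U> = G1_play natLeq \<sigma> ?U (length P)"
    unfolding response_def by (rule G1_play_cong) (auto simp: under_natLeq nth_append)
  ultimately show ?thesis by simp
qed

lemma play_eq_response: "G1_play natLeq \<sigma> U n = response \<sigma> (map U [0..<n]) (U n)"
proof -
  have "response \<sigma> (map U [0..<n]) (U n)
      = G1_play natLeq \<sigma> (\<lambda>i. (map U [0..<n] @ [U n]) ! i) n"
    by (simp add: response_def)
  also have "\<dots> = G1_play natLeq \<sigma> U n"
    by (rule G1_play_cong) (auto simp: under_natLeq nth_append)
  finally show ?thesis by simp
qed

text \<open>
  A strategy that wins cannot avoid a pi-base of sets at a position: a disjoint family that is maximal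
  within a pi-base is a maximal cellular family, so player one could offer only avoided sets.
\<close>

lemma open_set_of_responses:
  assumes \<sigma>: "G1_winning_strategy_two natLeq (maximal_cellular_families X) \<D> \<sigma>"
    and P: "set P \<subseteq> maximal_cellular_families X"
  shows "\<exists>G. openin X G \<and> G \<noteq> {} \<and> (\<forall>W. openin X W \<and> W \<noteq> {} \<and> W \<subseteq> G \<longrightarrow>
           (\<exists>\<U>\<in>maximal_cellular_families X. response \<sigma> P \<U> = W))"
proof (rule ccontr)
  let ?M = "maximal_cellular_families X"
  let ?N = "{W. openin X W \<and> W \<noteq> {} \<and> (\<forall>\<U>\<in>?M. response \<sigma> P \<U> \<noteq> W)}"
  assume no: "\<not> ?thesis"
  have dense: "\<exists>W\<in>?N. W \<subseteq> G" if "openin X G" "G \<noteq> {}" for G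
    using no[unfolded not_ex, THEN spec, of G] that by auto
  obtain \<U> where \<U>: "\<U> \<subseteq> ?N" "pairwise disjnt \<U>"
    and max: "\<forall>B\<in>?N. (\<forall>V\<in>\<U>. disjnt B V) \<longrightarrow> B \<in> \<U>"
    using maximal_disjoint_subfamily[of ?N] by (elim exE conjE) (rule that)
  have "\<V> = \<U>" if \<V>: "cellular X \<V>" "\<U> \<subseteq> \<V>" for \<V>
  proof (rule ccontr)
    assume "\<V> \<noteq> \<U>"
    then obtain G where G: "G \<in> \<V>" "G \<notin> \<U>" using \<V>(2) by blast
    then have "openin X G" "G \<noteq> {}" using \<V>(1) by (auto simp: cellular_def)
    then obtain W where W: "W \<in> ?N" "W \<subseteq> G" by (rule bexE[OF dense]) (rule that)
    have disj: "disjnt W V" if "V \<in> \<U>" for V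
    proof -
      have "V \<in> \<V>" "G \<noteq> V" using that \<V>(2) G by auto
      then have "disjnt G V" using \<V>(1) G(1) pairwiseD[of disjnt \<V> G V] by (simp add: cellular_def)
      then show ?thesis using W(2) by (auto simp: disjnt_def)
    qed
    then have "W \<in> \<U>" using bspec[OF max W(1)] by simp
    then have "disjnt W W" by (rule disj)
    then show False using W(1) by simp
  qed
  moreover have "cellular X \<U>" using \<U> by (auto simp: cellular_def)
  ultimately have M: "\<U> \<in> ?M" by (auto simp: maximal_cellular_families_def)
  have "response \<sigma> P \<U> \<in> ?N" by (rule subsetD[OF \<U>(1) response_in_move[OF \<sigma> P M]])
  then have "\<forall>\<U>'\<in>?M. response \<sigma> P \<U>' \<noteq> response \<sigma> P \<U>" by simp
  then show False using M by metis
qed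

text \<open>
  With \<open>G\<close> as in the previous lemma, a local pi-base at a point of \<open>G\<close> may be shrunk to its members
  inside \<open>G\<close>, all of which are answers.
\<close>

lemma countable_response_tree_node:
  assumes \<sigma>: "G1_winning_strategy_two natLeq (maximal_cellular_families X) \<D> \<sigma>"
    and P: "set P \<subseteq> maximal_cellular_families X" and \<chi>: "pi_character X \<le>o natLeq"
  shows "\<exists>x \<U>. x \<in> topspace X \<and> (\<forall>n. \<U> n \<in> maximal_cellular_families X) \<and>
           local_pi_base X x (range (\<lambda>n::nat. response \<sigma> P (\<U> n)))"
proof -
  let ?M = "maximal_cellular_families X"
  obtain G where G: "openin X G" "G \<noteq> {}"
    and resp: "\<forall>W. openin X W \<and> W \<noteq> {} \<and> W \<subseteq> G \<longrightarrow> (\<exists>\<U>\<in>?M. response \<sigma> P \<U> = W)"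
    using open_set_of_responses[OF \<sigma> P] by (elim exE conjE) (rule that)
  obtain x where x: "x \<in> G" using G by blast
  then have xX: "x \<in> topspace X" using openin_subset[OF G(1)] by blast
  then obtain \<B> where \<B>: "local_pi_base X x \<B>" "|\<B>| \<le>o pi_character X"
    by (rule obtain_local_pi_base)
  have "countable \<B>"
    unfolding countable_card_le_natLeq by (rule ordLeq_transitive[OF \<B>(2) \<chi>])
  define \<B>' where "\<B>' = {B \<in> \<B>. B \<subseteq> G}"
  have "\<B>' \<noteq> {}" using \<B>(1) x G by (auto simp: local_pi_base_def \<B>'_def)
  moreover have "countable \<B>'" using \<open>countable \<B>\<close> by (simp add: \<B>'_def)
  ultimately obtain e :: "nat \<Rightarrow> 'a set" where e: "range e = \<B>'"
    using range_from_nat_into by metis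
  have loc: "local_pi_base X x \<B>'"
    unfolding local_pi_base_def
  proof (intro conjI ballI allI impI)
    fix U assume "openin X U \<and> x \<in> U"
    then have "openin X (U \<inter> G)" "x \<in> U \<inter> G" using G x by auto
    then obtain B where "B \<in> \<B>" "B \<subseteq> U \<inter> G" using \<B>(1) unfolding local_pi_base_def by metis
    then show "\<exists>B\<in>\<B>'. B \<subseteq> U" by (auto simp: \<B>'_def)
  qed (use \<B>(1) in \<open>auto simp: local_pi_base_def \<B>'_def\<close>)
  have "\<exists>\<U>\<in>?M. response \<sigma> P \<U> = e n" for n
  proof (rule resp[rule_format])
    have "e n \<in> \<B>'" using e by blast
    then show "openin X (e n) \<and> e n \<noteq> {} \<and> e n \<subseteq> G"
      using loc by (simp add: local_pi_base_def \<B>'_def)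
  qed
  then obtain \<U> where "\<And>n. \<U> n \<in> ?M" "\<And>n. response \<sigma> P (\<U> n) = e n" by metis
  with e loc xX show ?thesis by (intro exI[of _ x] exI[of _ \<U>]) simp
qed

theorem countable_pi_weight_if_two_wins:
  fixes X :: "'a topology"
  assumes X: "almost_regular X"
    and \<sigma>: "G1_winning_strategy_two natLeq
              (maximal_cellular_families X) (dense_union_families X) \<sigma>"
    and \<chi>: "pi_character X \<le>o natLeq"
  shows "pi_weight X \<le>o natLeq"
proof -
  let ?M = "maximal_cellular_families X"
  have "\<exists>x \<U>. x \<in> topspace X \<and> (\<forall>n. \<U> n \<in> ?M) \<and>
          local_pi_base X x (range (\<lambda>n::nat. response \<sigma> P (\<U> n)))" if "P \<in> lists ?M" for P
    using that by (intro countable_response_tree_node[OF \<sigma> _ \<chi>]) (auto simp: in_lists_conv_set)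
  then obtain x \<U> where \<U>: "\<And>P n. P \<in> lists ?M \<Longrightarrow> \<U> P n \<in> ?M"
    and loc: "\<And>P. P \<in> lists ?M \<Longrightarrow>
           x P \<in> topspace X \<and> local_pi_base X (x P) (range (\<lambda>n::nat. response \<sigma> P (\<U> P n)))"
    by metis
  \<comment> \<open>The nodes of the tree are lists of numbers, latest choice first; \<open>pos\<close> lists the moves of
    player one on the way to the node, earliest move first.\<close>
  define pos where "pos ks = foldr (\<lambda>k P. P @ [\<U> P k]) ks []" for ks
  have pos_Nil: "pos [] = []" and pos_Cons: "pos (k # ks) = pos ks @ [\<U> (pos ks) k]" for k ks
    by (simp_all add: pos_def)
  have pos: "pos ks \<in> lists ?M" for ks
    by (induction ks) (use \<U> in \<open>auto simp: pos_Nil pos_Cons\<close>)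
  define W where "W ks n = response \<sigma> (pos ks) (\<U> (pos ks) n)" for ks n
  have W: "openin X (W ks n)" "W ks n \<noteq> {}" for ks n
    using loc[OF pos] unfolding local_pi_base_def W_def by blast+
  have W_local: "\<exists>n. W ks n \<subseteq> U" if "openin X U" "x (pos ks) \<in> U" for ks U
    using loc[OF pos, of ks] that unfolding local_pi_base_def W_def by blast
  define \<B> where "\<B> = range (\<lambda>(ks, n). W ks n)"
  have "\<exists>B\<in>\<B>. B \<subseteq> U" if U: "openin X U" "U \<noteq> {}" for U
  proof -
    obtain V where V: "openin X V" "V \<noteq> {}" "X closure_of V \<subseteq> U"
      using X U unfolding almost_regular_def by blast
    have VX: "V \<subseteq> X closure_of V" by (rule closure_of_subset[OF openin_subset[OF V(1)]])
    have "\<exists>ks. x (pos ks) \<in> U"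
    proof (rule ccontr)
      assume "\<not> ?thesis"
      then have "x (pos ks) \<in> topspace X - X closure_of V" for ks
        using V(3) loc[OF pos[of ks]] by auto
      then have "\<exists>n. W ks n \<subseteq> topspace X - X closure_of V" for ks
        by (intro W_local openin_diff) auto
      then obtain N where N: "\<And>ks. W ks (N ks) \<subseteq> topspace X - X closure_of V" by metis
      \<comment> \<open>The branch on which every answer misses \<open>V\<close>, and the run \<open>A\<close> of player one along it.\<close>
      define b where "b = rec_nat [] (\<lambda>_ ks. N ks # ks)"
      define A where "A m = \<U> (pos (b m)) (N (b m))" for m
      have posb: "pos (b m) = map A [0..<m]" for m
        by (induction m) (simp_all add: b_def pos_Nil pos_Cons A_def)
      have play: "G1_play natLeq \<sigma> A m = W (b m) (N (b m))" for m
        by (simp add: play_eq_response W_def flip: posb A_def)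
      have "\<forall>m\<in>Field natLeq. A m \<in> ?M" using \<U> pos by (simp add: A_def)
      then have "G1_play natLeq \<sigma> A ` Field natLeq \<in> dense_union_families X"
        using \<sigma>[unfolded G1_winning_strategy_two_def, THEN spec, of A] by simp
      then have "X closure_of (\<Union>m. W (b m) (N (b m))) = topspace X"
        by (simp add: dense_union_families_def play Field_natLeq)
      moreover have "V \<inter> X closure_of (\<Union>m. W (b m) (N (b m))) = {}"
        unfolding openin_Int_closure_of_eq_empty[OF V(1)] using N VX by blast
      ultimately show False using V(2) openin_subset[OF V(1)] by auto
    qed
    then obtain ks n where "W ks n \<subseteq> U" using W_local[OF U(1)] by metis
    then show ?thesis unfolding \<B>_def by (intro bexI[of _ "W ks n"]) auto
  qed
  then have "pi_base X \<B>" using W by (auto simp: pi_base_def \<B>_def)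
  moreover have "|\<B>| \<le>o natLeq"
    unfolding \<B>_def countable_card_le_natLeq[symmetric] by simp
  ultimately show ?thesis using natLeq_Cinfinite by (rule pi_weight_le)
qed

theorem theorem3p6:
  fixes X :: "'a topology"
  assumes "almost_regular X"
  shows "pi_weight X \<le>o pi_character X ^c cellularity X \<and>
    ((\<exists>\<sigma>. G1_winning_strategy_two natLeq
            (maximal_cellular_families X) (dense_union_families X) \<sigma>)
      \<and> pi_character X \<le>o natLeq
      \<longrightarrow> pi_weight X \<le>o natLeq)"
  using pi_weight_le_pi_character_cexp_cellularity[OF assms]
    countable_pi_weight_if_two_wins[OF assms] by blast

end
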